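(* Let $G_1$ and $G_2$ be finite simple connected graphs. If $G_1$ is not isomorphic to $K_{1,1}$, then the eccentricity matrix $\epsilon(G_1 \,\dot\vee\, G_2)$ of the subdivision-vertex join $G_1 \,\dot\vee\, G_2$ is irreducible.
   Context: All graphs are finite, simple and undirected. The subdivision graph $S(G)$ of a graph $G$ is obtained from $G$ by subdividing each edge with one new vertex; $I(G)$ is the set of these new vertices, so $V(S(G))=V(G)\cup I(G)$. For vertex-disjoint graphs $G_1,G_2$, the subdivision-vertex join $G_1\,\dot\vee\,G_2$ is obtained from $S(G_1)$ and $G_2$ by joining each vertex of $V(G_1)$ to every vertex of $V(G_2)$ (the vertices of $I(G_1)$ receive no new edges). For a connected graph $G$ with distance function $d$, the eccentricity of a vertex $v$ is $e(v)=\max\{d(v,u):u\in V(G)\}$. The eccentricity matrix $\epsilon(G)$ is the symmetric matrix indexed by $V(G)$ with $(u,v)$ entry $d(u,v)$ if $d(u,v)=\min\{e(u),e(v)\}$, and $0$ otherwise. A square matrix $N$ is reducible if there is a permutation matrix $P$ with $N=P^T\begin{pmatrix}A&B\\0&C\end{pmatrix}P$, where $A$ and $C$ are (nonempty) square blocks; it is irreducible otherwise. $K_{1,1}$ is the complete bipartite graph on $1+1$ vertices. *)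

theory Defs
  imports
    "Graph_Theory.Graph_Theory"
    "Jordan_Normal_Form.Matrix"
begin

text \<open>
  A finite simple undirected graph is a \<^locale>\<open>pair_graph\<close>: a finite, loop-free, symmetric set
  of pairs, so that an undirected edge is represented by its two opposite arcs.
\<close>

definition edge_set :: "'a pair_pre_digraph \<Rightarrow> 'a set set" where
  "edge_set G = {{u, v} | u v. (u, v) \<in> parcs G}"

text \<open>The vertex subdividing the edge \<^term>\<open>e\<close> is \<^term>\<open>Inr e\<close>.\<close>

definition subdivision_graph :: "'a pair_pre_digraph \<Rightarrow> ('a + 'a set) pair_pre_digraph" where
  "subdivision_graph G =
    \<lparr> pverts = Inl ` pverts G \<union> Inr ` edge_set G,
      parcs = {(Inl u, Inr e) | u e. e \<in> edge_set G \<and> u \<in> e}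
            \<union> {(Inr e, Inl u) | u e. e \<in> edge_set G \<and> u \<in> e} \<rparr>"

text \<open>Vertex-disjointness of the two graphs is realised by the outer sum type.\<close>

definition subdivision_vertex_join ::
    "'a pair_pre_digraph \<Rightarrow> 'b pair_pre_digraph \<Rightarrow> (('a + 'a set) + 'b) pair_pre_digraph" where
  "subdivision_vertex_join G1 G2 =
    \<lparr> pverts = Inl ` pverts (subdivision_graph G1) \<union> Inr ` pverts G2,
      parcs = {(Inl x, Inl y) | x y. (x, y) \<in> parcs (subdivision_graph G1)}
            \<union> {(Inr x, Inr y) | x y. (x, y) \<in> parcs G2}
            \<union> {(Inl (Inl u), Inr w) | u w. u \<in> pverts G1 \<and> w \<in> pverts G2}
            \<union> {(Inr w, Inl (Inl u)) | u w. u \<in> pverts G1 \<and> w \<in> pverts G2} \<rparr>"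

lemma pair_graph_subdivision_vertex_join:
  assumes "pair_graph G1" "pair_graph G2"
  shows "pair_graph (subdivision_vertex_join G1 G2)"
proof -
  interpret G1: pair_graph G1 by fact
  interpret G2: pair_graph G2 by fact
  let ?J = "subdivision_vertex_join G1 G2"
  have "edge_set G1 = (\<lambda>(u, v). {u, v}) ` parcs G1"
    by (auto simp: edge_set_def)
  then have "finite (edge_set G1)"
    using G1.pair_finite_arcs by simp
  then have fin: "finite (pverts ?J)"
    using G1.pair_finite_verts G2.pair_finite_verts
    by (simp add: subdivision_vertex_join_def subdivision_graph_def)
  have edge_verts: "u \<in> pverts G1" if "e \<in> edge_set G1" "u \<in> e" for u e
    using that G1.wellformed' by (auto simp: edge_set_def)
  have sub: "parcs ?J \<subseteq> pverts ?J \<times> pverts ?J"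
    using edge_verts G2.wellformed'
    by (auto simp: subdivision_vertex_join_def subdivision_graph_def)
  have "finite (parcs ?J)"
    using sub fin by (meson finite_SigmaI finite_subset)
  moreover have "sym (parcs ?J)"
    using G2.arcs_symmetric
    by (auto simp: subdivision_vertex_join_def subdivision_graph_def intro!: symI)
  moreover have "fst a \<noteq> snd a" if "a \<in> parcs ?J" for a
    using that G2.no_loops'
    by (auto simp: subdivision_vertex_join_def subdivision_graph_def)
  ultimately show ?thesis
    using fin sub by unfold_locales (auto simp: symmetric_def)
qed

text \<open>
  The length of a shortest walk. The library's \<^term>\<open>wf_digraph.\<mu>\<close> takes extended real values; on
  a connected graph, the only case of interest, it is finite for unit weights.
\<close>

definition graph_dist :: "'a pair_pre_digraph \<Rightarrow> 'a \<Rightarrow> 'a \<Rightarrow> real" where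
  "graph_dist G u v = real_of_ereal (wf_digraph.\<mu> (with_proj G) (\<lambda>_. 1) u v)"

definition eccentricity :: "'a pair_pre_digraph \<Rightarrow> 'a \<Rightarrow> real" where
  "eccentricity G v = Max {graph_dist G v u | u. u \<in> pverts G}"

text \<open>
  Matrices are indexed by natural numbers, so the eccentricity matrix is taken with respect to an
  enumeration \<^term>\<open>vs\<close> of the vertices without repetitions.
\<close>

definition eccentricity_mat :: "'a pair_pre_digraph \<Rightarrow> 'a list \<Rightarrow> real mat" where
  "eccentricity_mat G vs = mat (length vs) (length vs) (\<lambda>(i, j).
     if graph_dist G (vs ! i) (vs ! j) = min (eccentricity G (vs ! i)) (eccentricity G (vs ! j))
     then graph_dist G (vs ! i) (vs ! j) else 0)"

definition permutation_mat :: "nat \<Rightarrow> (nat \<Rightarrow> nat) \<Rightarrow> 'a :: semiring_1 mat" where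
  "permutation_mat n p = mat n n (\<lambda>(i, j). if p i = j then 1 else 0)"

definition reducible_mat :: "'a :: semiring_1 mat \<Rightarrow> bool" where
  "reducible_mat N \<longleftrightarrow> (\<exists>k m A B C p. 0 < k \<and> 0 < m
     \<and> A \<in> carrier_mat k k \<and> B \<in> carrier_mat k m \<and> C \<in> carrier_mat m m
     \<and> p permutes {..<k + m}
     \<and> N = transpose_mat (permutation_mat (k + m) p) * four_block_mat A B (0\<^sub>m m k) C
           * permutation_mat (k + m) p)"

definition irreducible_mat :: "'a :: semiring_1 mat \<Rightarrow> bool" where
  "irreducible_mat N \<longleftrightarrow> square_mat N \<and> \<not> reducible_mat N"

end

theory Submission
  imports Defs
begin

text \<open>
  An entry of the eccentricity matrix is nonzero as soon as one of its two vertices is farthest from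
  the other. In the join, every vertex of \<open>G\<^sub>2\<close> is at the maximal distance 2 from every subdivision
  vertex, and every vertex \<open>u\<close> of \<open>G\<^sub>1\<close> is at the maximal distance 3 from every edge that avoids it.
  If \<open>u\<close> lies on all edges, then it is at its maximal distance 2 from any other vertex of \<open>G\<^sub>1\<close>, which
  in turn is avoided by some edge since \<open>G\<^sub>1\<close> is not \<open>K\<^sub>1\<^sub>,\<^sub>1\<close>. So the nonzero entries form a connected
  graph on the index set. If \<open>G\<^sub>1\<close> is a single vertex, then that vertex is adjacent to all others and
  all off-diagonal entries of its row are nonzero.
\<close>

section \<open>Irreducibility and connectedness\<close>

text \<open>Row \<open>i\<close> of \<open>permutation_mat n p\<close> has its only 1 in column
  \<open>p i\<close>, so the sums of both products collapse to one term: the congruence merely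
  renames index \<open>i\<close> to \<open>p i\<close>.\<close>

lemma index_permutation_congruence:
  fixes M :: "'a :: semiring_1 mat"
  assumes M: "M \<in> carrier_mat n n" and p: "p permutes {..<n}" and "i < n" "j < n"
  shows "(transpose_mat (permutation_mat n p) * M * permutation_mat n p) $$ (p i, p j) = M $$ (i, j)"
proof -
  let ?P = "permutation_mat n p :: 'a mat"
  have P: "?P \<in> carrier_mat n n"
    by (simp add: permutation_mat_def)
  have less: "p i < n" if "i < n" for i
    using permutes_in_image[OF p, of i] that by simp
  have eq: "p a = p b \<longleftrightarrow> a = b" for a b
    using permutes_inj[OF p] by (simp add: inj_eq)
  have entry: "(L * R) $$ (a, c) = (\<Sum>b = 0..<n. L $$ (a, b) * R $$ (b, c))"
    if "L \<in> carrier_mat n n" "R \<in> carrier_mat n n" "a < n" "c < n" for L R :: "'a mat" and a c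
    using that by (simp add: scalar_prod_def)
  have left: "(transpose_mat ?P * M) $$ (p i, b) = M $$ (i, b)" if "b < n" for b
  proof -
    have "(transpose_mat ?P * M) $$ (p i, b) = (\<Sum>a = 0..<n. transpose_mat ?P $$ (p i, a) * M $$ (a, b))"
      using M P that less[OF \<open>i < n\<close>] by (intro entry) simp_all
    also have "\<dots> = (\<Sum>a = 0..<n. if a = i then M $$ (a, b) else 0)"
      using less[OF \<open>i < n\<close>] by (intro sum.cong) (auto simp: permutation_mat_def eq)
    finally show ?thesis
      using \<open>i < n\<close> by simp
  qed
  have "(transpose_mat ?P * M * ?P) $$ (p i, p j)
      = (\<Sum>b = 0..<n. (transpose_mat ?P * M) $$ (p i, b) * ?P $$ (b, p j))"
    using M P less \<open>i < n\<close> \<open>j < n\<close> by (intro entry mult_carrier_mat) simp_all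
  also have "\<dots> = (\<Sum>b = 0..<n. if b = j then M $$ (i, b) else 0)"
    using less \<open>j < n\<close> by (intro sum.cong) (auto simp: left, auto simp: permutation_mat_def eq)
  finally show ?thesis
    using \<open>j < n\<close> by simp
qed

text \<open>The zero block of a reduced form forbids nonzero entries from a row at or beyond
  \<open>k\<close> to a column below \<open>k\<close>. A path along nonzero entries therefore never
  leaves the renamed indices \<open>p a\<close> with \<open>k \<le> a\<close>.\<close>

lemma irreducible_matI:
  fixes N :: "'a :: semiring_1 mat"
  assumes N: "N \<in> carrier_mat n n"
    and conn: "\<And>i j. i < n \<Longrightarrow> j < n \<Longrightarrow> (i, j) \<in> {(i, j). i < n \<and> j < n \<and> N $$ (i, j) \<noteq> 0}\<^sup>*"
  shows "irreducible_mat N"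
  unfolding irreducible_mat_def
proof
  show "square_mat N"
    using N by auto
  show "\<not> reducible_mat N"
  proof
    assume "reducible_mat N"
    then obtain k m A B C p where km: "0 < k" "0 < m"
      and A: "A \<in> carrier_mat k k" and B: "B \<in> carrier_mat k m" and C: "C \<in> carrier_mat m m"
      and p: "p permutes {..<k + m}"
      and N_eq: "N = transpose_mat (permutation_mat (k + m) p) * four_block_mat A B (0\<^sub>m m k) C
           * permutation_mat (k + m) p"
      unfolding reducible_mat_def by blast
    let ?F = "four_block_mat A B (0\<^sub>m m k) C"
    have F: "?F \<in> carrier_mat (k + m) (k + m)"
      using A C by simp
    have n: "n = k + m"
      using N unfolding N_eq by (auto simp: permutation_mat_def)
    have less: "p i < n \<longleftrightarrow> i < n" for i
      using permutes_in_image[OF p, of i] n by simp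
    \<comment> \<open>The positive block sizes make \<open>k\<close> a row and \<open>0\<close> a
      column of the zero block.\<close>
    have "(p k, p 0) \<in> {(i, j). i < n \<and> j < n \<and> N $$ (i, j) \<noteq> 0}\<^sup>*"
      using km n less[of k] less[of 0] by (intro conn) simp_all
    moreover have "\<exists>a\<in>{k..<n}. j = p a"
      if "(p k, j) \<in> {(i, j). i < n \<and> j < n \<and> N $$ (i, j) \<noteq> 0}\<^sup>*" for j
      using that
    proof (induction rule: rtrancl_induct)
      case base
      then show ?case using km n by auto
    next
      case (step i j)
      then obtain a where a: "a \<in> {k..<n}" "i = p a" by blast
      obtain b where b: "j = p b"
        using permutes_surj[OF p] by (metis surjD)
      have "b < n" using step.hyps(2) b less by auto
      have "?F $$ (a, b) \<noteq> 0"
        using step.hyps(2) index_permutation_congruence[OF F p, of a b] a b \<open>b < n\<close> n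
        by (simp add: N_eq)
      then have "k \<le> b"
        using a \<open>b < n\<close> n A C by (cases "k \<le> b") auto
      then show ?case using b \<open>b < n\<close> by auto
    qed
    ultimately obtain a where "a \<in> {k..<n}" "p 0 = p a" by blast
    then show False
      using permutes_inj[OF p] km by (auto simp: inj_eq)
  qed
qed

section \<open>Distances and walks\<close>

text \<open>Powers of the arc relation replace walks, so that short distances become plain
  statements about arcs.\<close>

lemma (in pair_wf_digraph) awalk_imp_relpow:
  "awalk u p v \<Longrightarrow> (u, v) \<in> parcs G ^^ length p"
  by (induction p arbitrary: u) (auto simp: awalk_Nil_iff awalk_Cons_iff intro: relpow_Suc_I2 simp del: relpow.simps(2))

lemma (in pair_wf_digraph) relpow_imp_awalk:
  "(u, v) \<in> parcs G ^^ n \<Longrightarrow> u \<in> pverts G \<Longrightarrow> \<exists>p. awalk u p v \<and> length p = n"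
proof (induction n arbitrary: u)
  case 0
  then show ?case by (auto simp: awalk_Nil_iff)
next
  case (Suc n)
  then obtain w where w: "(u, w) \<in> parcs G" "(w, v) \<in> parcs G ^^ n"
    by (metis relpow_Suc_D2)
  with Suc.IH obtain p where "awalk w p v" "length p = n"
    using wellformed' by blast
  then have "awalk u ((u, w) # p) v \<and> length ((u, w) # p) = Suc n"
    using w by (simp add: awalk_Cons_iff)
  then show ?case by blast
qed

lemma (in wf_digraph) awalk_cost_unit: "awalk_cost (\<lambda>_. 1) p = real (length p)"
  by (induction p) auto

lemma graph_dist_eqI:
  assumes "pair_wf_digraph G" and u: "u \<in> pverts G"
    and walk: "(u, v) \<in> parcs G ^^ n" and min: "\<And>m. m < n \<Longrightarrow> (u, v) \<notin> parcs G ^^ m"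
  shows "graph_dist G u v = real n"
proof -
  interpret pair_wf_digraph G by fact
  obtain p where p: "awalk u p v" "length p = n"
    using relpow_imp_awalk walk u by blast
  have "\<mu> (\<lambda>_. 1) u v = ereal (real n)"
  proof (rule antisym)
    show "\<mu> (\<lambda>_. 1) u v \<le> ereal (real n)"
      using min_cost_le_walk_cost[OF p(1), of "\<lambda>_. 1"] p(2) by (simp add: awalk_cost_unit)
    show "ereal (real n) \<le> \<mu> (\<lambda>_. 1) u v"
      unfolding \<mu>_def
    proof (rule INF_greatest)
      fix q assume "q \<in> {p. awalk u p v}"
      then have "\<not> length q < n"
        using awalk_imp_relpow min by blast
      then show "ereal (real n) \<le> ereal (awalk_cost (\<lambda>_. 1) q)"
        by (simp add: awalk_cost_unit)
    qed
  qed
  then show ?thesis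
    by (simp add: graph_dist_def)
qed

lemma relpow_swap:
  assumes "sym R" "(x, y) \<in> R ^^ n"
  shows "(y, x) \<in> R ^^ n"
  using assms(2)
proof (induction n arbitrary: y)
  case (Suc n)
  then obtain z where "(x, z) \<in> R ^^ n" "(z, y) \<in> R"
    by auto
  then show ?case
    using Suc.IH assms(1) by (meson relpow_Suc_I2 symD)
qed auto

text \<open>This says that \<open>n\<close> is both the distance from \<open>x\<close> to
  \<open>y\<close> and the eccentricity of \<open>x\<close>, in terms of walk lengths only, so that
  no infimum or maximum has to be evaluated in the join.\<close>

definition farthest :: "'a pair_pre_digraph \<Rightarrow> nat \<Rightarrow> 'a \<Rightarrow> 'a \<Rightarrow> bool" where
  "farthest G n x y \<longleftrightarrow> x \<in> pverts G \<and> y \<in> pverts G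
     \<and> (\<forall>m<n. (x, y) \<notin> parcs G ^^ m)
     \<and> (\<forall>z\<in>pverts G. \<exists>m\<le>n. (x, z) \<in> parcs G ^^ m)"

lemma graph_dist_le_eccentricity:
  assumes "finite (pverts G)" "y \<in> pverts G"
  shows "graph_dist G x y \<le> eccentricity G x"
  unfolding eccentricity_def using assms by (intro Max_ge) auto

text \<open>The distance \<open>n\<close> is the eccentricity of \<open>x\<close> and at most that
  of \<open>y\<close>, hence it is the smaller of the two and appears as the matrix entry.\<close>

lemma farthest_imp_dist:
  assumes "pair_graph G" "farthest G n x y"
  shows "graph_dist G x y = n" "graph_dist G y x = n" "eccentricity G x = n"
    "n \<le> eccentricity G y"
proof -
  interpret pair_graph G by fact
  have V: "x \<in> pverts G" "y \<in> pverts G" and min: "\<And>m. m < n \<Longrightarrow> (x, y) \<notin> parcs G ^^ m"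
    and all: "\<And>z. z \<in> pverts G \<Longrightarrow> \<exists>m\<le>n. (x, z) \<in> parcs G ^^ m"
    using assms(2) by (auto simp: farthest_def)
  have sym: "sym (parcs G)"
    using pair_sym_arcs by (simp add: symmetric_def)
  have xy: "(x, y) \<in> parcs G ^^ n"
    using all[OF V(2)] min by (metis le_neq_implies_less)
  show dist: "graph_dist G x y = n"
    using V xy min by (intro graph_dist_eqI) unfold_locales
  show dist': "graph_dist G y x = n"
    using V relpow_swap[OF sym] xy min by (intro graph_dist_eqI) (unfold_locales, blast+)
  have le: "graph_dist G x z \<le> n" if z: "z \<in> pverts G" for z
  proof -
    obtain m where m: "m \<le> n" "(x, z) \<in> parcs G ^^ m"
      using all[OF z] by blast
    \<comment> \<open>The given walk need not be shortest, while \<open>graph_dist_eqI\<close>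
      requires the least length.\<close>
    define l where "l = (LEAST l. (x, z) \<in> parcs G ^^ l)"
    have "(x, z) \<in> parcs G ^^ l" "l \<le> m"
      unfolding l_def using m by (auto intro: LeastI Least_le)
    moreover have "(x, z) \<notin> parcs G ^^ i" if "i < l" for i
      using that not_less_Least unfolding l_def by blast
    ultimately have "graph_dist G x z = l"
      using V by (intro graph_dist_eqI) unfold_locales
    then show ?thesis using \<open>l \<le> m\<close> m by simp
  qed
  show ecc: "eccentricity G x = n"
    unfolding eccentricity_def
  proof (rule Max_eqI)
    show "finite {graph_dist G x u |u. u \<in> pverts G}"
      using pair_finite_verts by simp
    show "real n \<in> {graph_dist G x u |u. u \<in> pverts G}"
      using dist V by (auto intro!: exI[of _ y])
  qed (use le in auto)
  show "n \<le> eccentricity G y"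
    using dist' graph_dist_le_eccentricity[OF pair_finite_verts V(1), of y] by simp
qed

text \<open>By symmetry it suffices to reach one hub \<open>r\<close> from every vertex. The
  condition \<open>n > 0\<close> matters, since an entry equal to a zero distance would not count as
  nonzero.\<close>

lemma irreducible_eccentricity_matI:
  assumes G: "pair_graph G" and vs: "distinct vs" "set vs = pverts G"
    and r: "\<And>x. x \<in> pverts G \<Longrightarrow>
      (x, r) \<in> {(x, y). \<exists>n>0. farthest G n x y \<or> farthest G n y x}\<^sup>*"
  shows "irreducible_mat (eccentricity_mat G vs)"
proof (rule irreducible_matI)
  let ?N = "eccentricity_mat G vs" and ?n = "length vs"
  let ?E = "{(i, j). i < ?n \<and> j < ?n \<and> ?N $$ (i, j) \<noteq> 0}"
  let ?F = "{(x, y). \<exists>n>0. farthest G n x y \<or> farthest G n y x}"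
  show "?N \<in> carrier_mat ?n ?n"
    by (simp add: eccentricity_mat_def)
  have edgeI: "(i, j) \<in> ?E" if "(vs ! i, vs ! j) \<in> ?F" "i < ?n" "j < ?n" for i j
    using that by (auto simp: farthest_imp_dist[OF G] eccentricity_mat_def min_absorb1 min_absorb2)
  have lift: "(i, j) \<in> ?E\<^sup>*" if "(x, y) \<in> ?F\<^sup>*" "i < ?n" "j < ?n" "x = vs ! i" "y = vs ! j"
    for x y i j
    using that
  proof (induction arbitrary: j rule: rtrancl_induct)
    case base
    then show ?case using vs(1) by (simp add: nth_eq_iff_index_eq)
  next
    case (step y z)
    \<comment> \<open>Both vertices of a farthest pair belong to the graph, so intermediate vertices
      of the path have an index too.\<close>
    have "y \<in> set vs"
      using step.hyps(2) vs(2) by (auto simp: farthest_def)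
    then obtain k where "k < ?n" "y = vs ! k"
      by (auto simp: in_set_conv_nth)
    then have "(i, k) \<in> ?E\<^sup>*"
      using step.IH step.prems by blast
    moreover have "(k, j) \<in> ?E"
      using step.hyps(2) step.prems \<open>k < ?n\<close> \<open>y = vs ! k\<close> by (intro edgeI) simp_all
    ultimately show ?case
      by (rule rtrancl_into_rtrancl)
  qed
  have "sym (?F\<^sup>*)"
    by (intro sym_rtrancl symI) auto
  fix i j assume ij: "i < ?n" "j < ?n"
  then have "(vs ! i, r) \<in> ?F\<^sup>*" "(vs ! j, r) \<in> ?F\<^sup>*"
    using r vs(2) nth_mem by blast+
  with \<open>sym (?F\<^sup>*)\<close> have "(vs ! i, vs ! j) \<in> ?F\<^sup>*"
    by (meson rtrancl_trans symD)
  then show "(i, j) \<in> ?E\<^sup>*"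
    using lift ij by blast
qed

section \<open>The subdivision-vertex join\<close>

lemma connected_pair_graph_edge:
  assumes "pair_graph G" "connected (with_proj G)"
    and "u \<in> pverts G" "v \<in> pverts G" "u \<noteq> v"
  shows "\<exists>x. (u, x) \<in> parcs G"
proof -
  interpret pair_graph G by fact
  \<comment> \<open>Connectedness speaks of the symmetric closure, which leaves reachability
    unchanged for symmetric arcs; the first arc of a walk to \<open>v\<close> is the one
    sought.\<close>
  have "u \<rightarrow>\<^sup>*\<^bsub>mk_symmetric (with_proj G)\<^esub> v"
    using assms(2-4) by (auto simp: connected_def strongly_connected_def)
  then have "u \<rightarrow>\<^sup>*\<^bsub>with_proj G\<^esub> v"
    by (simp only: reachable_mk_symmetric_eq[OF pair_sym_arcs])
  then show ?thesis
    using \<open>u \<noteq> v\<close> by (metis converse_reachable_cases)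
qed

text \<open>On two vertices, connectedness forces both arcs between them and loop-freeness excludes
  all others, which gives K_{1,1}. This is how the exclusion of K_{1,1} enters.\<close>

lemma connected_pair_graph_third_vertex:
  assumes "pair_graph G" "connected (with_proj G)" "\<not> K\<^bsub>1,1\<^esub> (with_proj G)"
    and ab: "a \<in> pverts G" "b \<in> pverts G" "a \<noteq> b"
  obtains c where "c \<in> pverts G" "c \<noteq> a" "c \<noteq> b"
proof -
  interpret pair_graph G by fact
  have False if V: "pverts G = {a, b}"
  proof -
    obtain x where "(a, x) \<in> parcs G"
      using connected_pair_graph_edge assms by metis
    then have "(a, b) \<in> parcs G" "(b, a) \<in> parcs G"
      using V no_loops' wellformed' arcs_symmetric by blast+
    moreover have "parcs G \<subseteq> {(a, b), (b, a)}"
    proof (rule subrelI)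
      fix v w assume vw: "(v, w) \<in> parcs G"
      show "(v, w) \<in> {(a, b), (b, a)}"
        using V no_loops'[OF vw] wellformed'[OF vw] by auto
    qed
    ultimately have "parcs G = {a} \<times> {b} \<union> {b} \<times> {a}"
      by auto
    moreover have "pverts G = {a} \<union> {b}" "{a} \<inter> {b} = {}" "card {a} = 1" "card {b} = 1"
      using V ab by auto
    ultimately have "K\<^bsub>1,1\<^esub> (with_proj G)"
      unfolding complete_bipartite_digraph_pair_def using pair_finite_verts by metis
    then show False using assms by blast
  qed
  then show thesis using that ab by blast
qed

lemma in_pverts_join:
  "Inr w \<in> pverts (subdivision_vertex_join G1 G2) \<longleftrightarrow> w \<in> pverts G2"
  "Inl (Inl u) \<in> pverts (subdivision_vertex_join G1 G2) \<longleftrightarrow> u \<in> pverts G1"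
  "Inl (Inr e) \<in> pverts (subdivision_vertex_join G1 G2) \<longleftrightarrow> e \<in> edge_set G1"
  by (auto simp: subdivision_vertex_join_def subdivision_graph_def)

lemma in_parcs_join:
  "(Inr w, Inr w') \<in> parcs (subdivision_vertex_join G1 G2) \<longleftrightarrow> (w, w') \<in> parcs G2"
  "(Inr w, Inl (Inl u)) \<in> parcs (subdivision_vertex_join G1 G2) \<longleftrightarrow> u \<in> pverts G1 \<and> w \<in> pverts G2"
  "(Inl (Inl u), Inr w) \<in> parcs (subdivision_vertex_join G1 G2) \<longleftrightarrow> u \<in> pverts G1 \<and> w \<in> pverts G2"
  "(Inr w, Inl (Inr e)) \<notin> parcs (subdivision_vertex_join G1 G2)"
  "(Inl (Inr e), Inr w) \<notin> parcs (subdivision_vertex_join G1 G2)"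
  "(Inl (Inl u), Inl (Inl u')) \<notin> parcs (subdivision_vertex_join G1 G2)"
  "(Inl (Inr e), Inl (Inr e')) \<notin> parcs (subdivision_vertex_join G1 G2)"
  "(Inl (Inl u), Inl (Inr e)) \<in> parcs (subdivision_vertex_join G1 G2) \<longleftrightarrow> e \<in> edge_set G1 \<and> u \<in> e"
  "(Inl (Inr e), Inl (Inl u)) \<in> parcs (subdivision_vertex_join G1 G2) \<longleftrightarrow> e \<in> edge_set G1 \<and> u \<in> e"
  by (auto simp: subdivision_vertex_join_def subdivision_graph_def)

lemma join_vertex_cases:
  assumes "x \<in> pverts (subdivision_vertex_join G1 G2)"
  obtains (left) u where "x = Inl (Inl u)" "u \<in> pverts G1"
    | (edge) e where "x = Inl (Inr e)" "e \<in> edge_set G1"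
    | (right) w where "x = Inr w" "w \<in> pverts G2"
  using assms by (auto simp: subdivision_vertex_join_def subdivision_graph_def)

lemma all_less_numeral_simps:
  "(\<forall>m<2. P m) \<longleftrightarrow> P 0 \<and> P (1::nat)"
  "(\<forall>m<3. P m) \<longleftrightarrow> P 0 \<and> P (1::nat) \<and> P 2"
  by (auto simp: numeral_eq_Suc less_Suc_eq)

lemma ex_le_numeral_simps:
  "(\<exists>m\<le>2. P m) \<longleftrightarrow> P 0 \<or> P (1::nat) \<or> P 2"
  "(\<exists>m\<le>3. P m) \<longleftrightarrow> P 0 \<or> P (1::nat) \<or> P 2 \<or> P 3"
  by (auto simp: numeral_eq_Suc le_Suc_eq)

lemma relpow_2_iff: "(x, y) \<in> R ^^ 2 \<longleftrightarrow> (\<exists>z. (x, z) \<in> R \<and> (z, y) \<in> R)"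
  by (auto simp: numeral_2_eq_2)

lemma relpow_3_iff:
  "(x, y) \<in> R ^^ 3 \<longleftrightarrow> (\<exists>z z'. (x, z) \<in> R \<and> (z, z') \<in> R \<and> (z', y) \<in> R)"
  by (auto simp: numeral_3_eq_3)

lemma ex_sum_iff: "(\<exists>x. P x) \<longleftrightarrow> (\<exists>x. P (Inl x)) \<or> (\<exists>x. P (Inr x))"
  by (metis sum.exhaust)

text \<open>These rules turn a distance claim up to 3 into a case analysis over the three kinds of
  intermediate vertices.\<close>

lemmas join_simps = in_pverts_join in_parcs_join all_less_numeral_simps ex_le_numeral_simps
  relpow_2_iff relpow_3_iff ex_sum_iff

lemma edge_set_vertex:
  assumes "pair_graph G" "e \<in> edge_set G"
  obtains u where "u \<in> e" "u \<in> pverts G"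
proof -
  interpret pair_graph G by fact
  show thesis using assms(2) that wellformed' by (auto simp: edge_set_def)
qed

text \<open>A subdivision vertex is adjacent only to the ends of its edge, all of which are
  neighbours of \<open>w\<close>. Other vertices of \<open>G2\<close> are reached through any vertex
  \<open>u\<close> of \<open>G1\<close>.\<close>

lemma farthest_join_right:
  assumes "pair_graph G1" "w \<in> pverts G2" "e \<in> edge_set G1"
  shows "farthest (subdivision_vertex_join G1 G2) 2 (Inr w) (Inl (Inr e))"
proof -
  obtain u where u: "u \<in> pverts G1"
    using edge_set_vertex[OF assms(1,3)] by blast
  have "\<exists>m\<le>2. (Inr w, z) \<in> parcs (subdivision_vertex_join G1 G2) ^^ m"
    if "z \<in> pverts (subdivision_vertex_join G1 G2)" for z
    using that
  proof (cases rule: join_vertex_cases)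
    case (edge f)
    obtain v where "v \<in> f" "v \<in> pverts G1"
      using edge_set_vertex[OF assms(1) edge(2)] by blast
    with edge show ?thesis
      using assms by (auto simp: join_simps)
  qed (use assms u in \<open>auto simp: join_simps\<close>)
  then show ?thesis
    using assms by (auto simp: farthest_def join_simps)
qed

text \<open>A walk of length 2 from \<open>u\<close> to \<open>e\<close> would pass through an end
  of \<open>e\<close>, but vertices of \<open>G1\<close> are not adjacent to each other in the join.
  The route \<open>u\<close>, \<open>w\<close>, \<open>v\<close>, \<open>f\<close> with
  \<open>v\<close> on \<open>f\<close> bounds the distance to any edge \<open>f\<close> by
  3.\<close>

lemma farthest_join_left:
  assumes "pair_graph G1" "u \<in> pverts G1" "e \<in> edge_set G1" "u \<notin> e" "w \<in> pverts G2"
  shows "farthest (subdivision_vertex_join G1 G2) 3 (Inl (Inl u)) (Inl (Inr e))"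
proof -
  have "\<exists>m\<le>3. (Inl (Inl u), z) \<in> parcs (subdivision_vertex_join G1 G2) ^^ m"
    if "z \<in> pverts (subdivision_vertex_join G1 G2)" for z
    using that
  proof (cases rule: join_vertex_cases)
    case (edge f)
    obtain v where "v \<in> f" "v \<in> pverts G1"
      using edge_set_vertex[OF assms(1) edge(2)] by blast
    with edge show ?thesis
      using assms by (auto simp: join_simps)
  qed (use assms in \<open>auto simp: join_simps\<close>)
  then show ?thesis
    using assms by (auto simp: farthest_def join_simps)
qed

text \<open>Here all subdivision vertices and all of \<open>G2\<close> are neighbours of
  \<open>u\<close>, and \<open>w\<close> links \<open>u\<close> to the other vertices of
  \<open>G1\<close>.\<close>

lemma farthest_join_center:
  assumes "u \<in> pverts G1" "v \<in> pverts G1" "u \<noteq> v"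
    "\<And>e. e \<in> edge_set G1 \<Longrightarrow> u \<in> e" "w \<in> pverts G2"
  shows "farthest (subdivision_vertex_join G1 G2) 2 (Inl (Inl u)) (Inl (Inl v))"
proof -
  have "\<exists>m\<le>2. (Inl (Inl u), z) \<in> parcs (subdivision_vertex_join G1 G2) ^^ m"
    if "z \<in> pverts (subdivision_vertex_join G1 G2)" for z
    using that by (cases rule: join_vertex_cases) (use assms in \<open>auto simp: join_simps\<close>)
  then show ?thesis
    using assms by (auto simp: farthest_def join_simps)
qed

lemma edge_set_singleton:
  assumes "pair_graph G" "pverts G = {u}"
  shows "edge_set G = {}"
proof -
  interpret pair_graph G by fact
  have "v = u \<and> w = u \<and> v \<noteq> w" if "(v, w) \<in> parcs G" for v w
    using that assms(2) wellformed'[OF that] no_loops'[OF that] by simp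
  then show ?thesis
    unfolding edge_set_def by blast
qed

lemma farthest_join_single:
  assumes "pair_graph G1" "pverts G1 = {u}" "w \<in> pverts G2"
  shows "farthest (subdivision_vertex_join G1 G2) 1 (Inl (Inl u)) (Inr w)"
proof -
  have "\<exists>m\<le>1. (Inl (Inl u), z) \<in> parcs (subdivision_vertex_join G1 G2) ^^ m"
    if "z \<in> pverts (subdivision_vertex_join G1 G2)" for z
    using that
    by (cases rule: join_vertex_cases)
      (use assms edge_set_singleton[OF assms(1,2)] in \<open>auto simp: in_parcs_join le_Suc_eq\<close>)
  then show ?thesis
    using assms by (auto simp: farthest_def in_pverts_join)
qed

theorem theorem3p1:
  fixes G1 :: "'a pair_pre_digraph" and G2 :: "'b pair_pre_digraph"
    and vs :: "(('a + 'a set) + 'b) list"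
  assumes "pair_graph G1" and "connected (with_proj G1)"
    and "pair_graph G2" and "connected (with_proj G2)"
    and "\<not> K\<^bsub>1,1\<^esub> (with_proj G1)"
    and "distinct vs" and "set vs = pverts (subdivision_vertex_join G1 G2)"
  shows "irreducible_mat (eccentricity_mat (subdivision_vertex_join G1 G2) vs)"
proof -
  let ?J = "subdivision_vertex_join G1 G2"
  let ?F = "{(x, y). \<exists>n>0. farthest ?J n x y \<or> farthest ?J n y x}"
  have J: "pair_graph ?J"
    using assms by (simp add: pair_graph_subdivision_vertex_join)
  obtain a where a: "a \<in> pverts G1"
    using assms(2) by (auto simp: connected_def strongly_connected_def)
  obtain w where w: "w \<in> pverts G2"
    using assms(4) by (auto simp: connected_def strongly_connected_def)
  have F: "(x, y) \<in> ?F" "(y, x) \<in> ?F" if "farthest ?J n x y" "n > 0" for n x y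
    using that by auto
  show ?thesis
  proof (cases "pverts G1 = {a}")
    case True
    \<comment> \<open>There are no subdivision vertices in this case, so the single vertex
      \<open>a\<close> serves as hub.\<close>
    have w_a: "(Inr w', Inl (Inl a)) \<in> ?F" if "w' \<in> pverts G2" for w'
      by (rule F[OF farthest_join_single[OF assms(1) True that]]) simp
    show ?thesis
    proof (rule irreducible_eccentricity_matI[OF J assms(6,7)])
      fix x assume "x \<in> pverts ?J"
      then show "(x, Inl (Inl a)) \<in> ?F\<^sup>*"
      proof (cases rule: join_vertex_cases)
        case (left u)
        then show ?thesis using True by simp
      next
        case (edge e)
        then show ?thesis
          using edge_set_singleton[OF assms(1) True] by simp
      next
        case (right v)
        then show ?thesis using w_a by blast
      qed
    qed
  next
    case False
    have edge_at: "\<exists>v. {u, v} \<in> edge_set G1" if u: "u \<in> pverts G1" for u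
    proof -
      obtain v where "v \<in> pverts G1" "u \<noteq> v" using False a u by blast
      then obtain x where "(u, x) \<in> parcs G1"
        using connected_pair_graph_edge[OF assms(1,2) u] by blast
      then show ?thesis
        unfolding edge_set_def by blast
    qed
    have e_w: "(Inl (Inr e), Inr v) \<in> ?F" if "e \<in> edge_set G1" "v \<in> pverts G2" for e v
      by (rule F[OF farthest_join_right[OF assms(1) that(2,1)]]) simp
    have u_e: "(Inl (Inl u), Inl (Inr e)) \<in> ?F" if "u \<in> pverts G1" "e \<in> edge_set G1" "u \<notin> e" for u e
      by (rule F[OF farthest_join_left[OF assms(1) that w]]) simp
    \<comment> \<open>The hub is now \<open>Inr w\<close>, reached from \<open>u\<close> through an
      edge that avoids \<open>u\<close>.\<close>
    have u_w: "(Inl (Inl u), Inr w) \<in> ?F\<^sup>*" if "u \<in> pverts G1" "e \<in> edge_set G1" "u \<notin> e" for u e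
      using u_e[OF that] e_w[OF that(2) w] by (meson r_into_rtrancl rtrancl_trans)
    show ?thesis
    proof (rule irreducible_eccentricity_matI[OF J assms(6,7)])
      fix x assume "x \<in> pverts ?J"
      then show "(x, Inr w) \<in> ?F\<^sup>*"
      proof (cases rule: join_vertex_cases)
        case (left u)
        show ?thesis
        proof (cases "\<exists>e\<in>edge_set G1. u \<notin> e")
          case True
          then show ?thesis using u_w left by blast
        next
          case on_all: False
          \<comment> \<open>No edge avoids \<open>u\<close>, so the path takes a detour over another
            vertex \<open>v\<close>, which needs an edge avoiding \<open>v\<close>.\<close>
          obtain v where v: "v \<in> pverts G1" "u \<noteq> v"
            using False a left(2) by blast
          obtain c where c: "c \<in> pverts G1" "c \<noteq> u" "c \<noteq> v"
            using connected_pair_graph_third_vertex[OF assms(1,2,5) left(2) v] by blast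
          obtain d where d: "{c, d} \<in> edge_set G1"
            using edge_at[OF c(1)] by blast
          \<comment> \<open>Every edge contains \<open>u\<close>, so the edge at the third vertex
            \<open>c\<close> is the one joining \<open>c\<close> and \<open>u\<close>; it avoids
            \<open>v\<close>.\<close>
          then have "u \<in> {c, d}"
            using on_all d by metis
          then have "v \<notin> {c, d}"
            using c v by auto
          then have "(Inl (Inl v), Inr w) \<in> ?F\<^sup>*"
            using u_w[OF v(1) d] by blast
          moreover have "(Inl (Inl u), Inl (Inl v)) \<in> ?F"
            by (rule F[OF farthest_join_center[OF left(2) v _ w]]) (use on_all in auto)
          ultimately show ?thesis
            unfolding left(1) by (rule converse_rtrancl_into_rtrancl[rotated])
        qed
      next
        case (edge e)
        then show ?thesis using e_w w by blast
      next
        case (right v)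
        \<comment> \<open>Any one edge will do: its subdivision vertex forms a farthest pair with
          every vertex of \<open>G2\<close>, hence links \<open>v\<close> to
          \<open>w\<close>.\<close>
        obtain b where "{a, b} \<in> edge_set G1"
          using edge_at[OF a] by blast
        then have "(Inr v, Inl (Inr {a, b})) \<in> ?F" "(Inl (Inr {a, b}), Inr w) \<in> ?F"
          using e_w right(2) w by auto
        then show ?thesis
          using right(1) by (meson r_into_rtrancl rtrancl_trans)
      qed
    qed
  qed
qed

end
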